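(* Let $R$ be a ring that satisfies property $(\star)$, exhibited by $\mathfrak{m}\in\mathrm{Max}(R)$ and a field $\kappa\subseteq R$. Assume that $R\setminus\mathfrak{m}$ does not contain any zero divisors. Then the localization $R_{\mathfrak{m}}$ of $R$ at $\mathfrak{m}$ satisfies property $(\star)$. More precisely, $\mathfrak{m}R_{\mathfrak{m}}$ is the only maximal ideal of $R_{\mathfrak{m}}$ and $$R_{\mathfrak{m}}/(\mathfrak{m}R_{\mathfrak{m}})\cong\kappa\subseteq R\subseteq R_{\mathfrak{m}}.$$
   Context: Rings are unitary, ring homomorphisms preserve $1$, ideals are two-sided, and subfields of a ring share its $1$. $\mathrm{Max}(R)$ is the set of maximal ideals of $R$. Property $(\star)$ for a ring $R$: there exists a maximal ideal $\mathfrak{m}$ of $R$ such that the canonical projection $\pi\colon R\to R/\mathfrak{m}$ has a section, so that $R/\mathfrak{m}$ is isomorphic to a field $\kappa$ contained in $R$. One says that $\mathfrak{m}\in\mathrm{Max}(R)$ and a field $\kappa\subseteq R$ exhibit property $(\star)$ for $R$ if there is a ring isomorphism $j\colon R/\mathfrak{m}\to\kappa$ such that the composite $s\colon R/\mathfrak{m}\xrightarrow{j}\kappa\subseteq R$ satisfies $\pi\circ s=\mathrm{id}$. The localization $R_{\mathfrak{m}}$ is the ring of fractions $\frac{a}{b}$ with $a\in R$ and $b\in R\setminus\mathfrak{m}$, and $R$ is regarded as contained in $R_{\mathfrak{m}}$ via $a\mapsto\frac{a}{1}$.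
   Formalization: For noncommutative R the ring of fractions a/b may not exist (e.g. k<x,y>, m=(x,y)); the formal theorem reads a/b as ab^{-1} and assumes R\m satisfies the right Ore condition, which is automatic for commutative R; left fractions follow via the opposite ring. *)

theory Defs
  imports "HOL-Algebra.Algebra"
begin

text \<open>
  Rings are the (unital, not necessarily commutative) rings of HOL-Algebra; ideals are two-sided.
  A subfield of a ring contains the \<open>\<one>\<close> of that ring and is commutative.
\<close>

definition exhibits_star :: "('a, 'm) ring_scheme \<Rightarrow> 'a set \<Rightarrow> 'a set \<Rightarrow> bool" where
  "exhibits_star R \<mm> \<kappa> \<longleftrightarrow>
     maximalideal \<mm> R \<and> subfield \<kappa> R \<and>
     (\<exists>j \<in> ring_iso (R Quot \<mm>) (R\<lparr>carrier := \<kappa>\<rparr>).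
        \<forall>C \<in> carrier (R Quot \<mm>). \<mm> +>\<^bsub>R\<^esub> j C = C)"

definition property_star :: "('a, 'm) ring_scheme \<Rightarrow> bool" where
  "property_star R \<longleftrightarrow> (\<exists>\<mm> \<kappa>. exhibits_star R \<mm> \<kappa>)"

text \<open>In a nonzero ring, \<open>\<zero>\<close> counts as a zero divisor; left and right zero divisors both count.\<close>

definition zero_divisor :: "('a, 'm) ring_scheme \<Rightarrow> 'a \<Rightarrow> bool" where
  "zero_divisor R a \<longleftrightarrow>
     a \<in> carrier R \<and>
     (\<exists>x \<in> carrier R - {\<zero>\<^bsub>R\<^esub>}. a \<otimes>\<^bsub>R\<^esub> x = \<zero>\<^bsub>R\<^esub> \<or> x \<otimes>\<^bsub>R\<^esub> a = \<zero>\<^bsub>R\<^esub>)"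

text \<open>
  For a multiplicatively closed set \<open>S\<close> without zero divisors, a ring of (right) fractions
  \<open>a/s = a s\<^sup>-\<^sup>1\<close> exists if and only if \<open>S\<close> satisfies the right Ore condition
  below (Ore's theorem). In a commutative ring this condition always holds.
\<close>

definition right_Ore :: "('a, 'm) ring_scheme \<Rightarrow> 'a set \<Rightarrow> bool" where
  "right_Ore R S \<longleftrightarrow>
     (\<forall>a \<in> carrier R. \<forall>s \<in> S. \<exists>b \<in> carrier R. \<exists>t \<in> S. a \<otimes>\<^bsub>R\<^esub> t = s \<otimes>\<^bsub>R\<^esub> b)"

lemma (in cring) right_Ore_if_commutative:
  assumes "S \<subseteq> carrier R"
  shows "right_Ore R S"
  using assms m_comm unfolding right_Ore_def by blast

text \<open>
  \<open>a/s = b/t\<close> if and only if the two fractions can be expanded to the same numerator and the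
  same denominator in \<open>S\<close>.
\<close>

definition frac_rel :: "('a, 'm) ring_scheme \<Rightarrow> 'a set \<Rightarrow> (('a \<times> 'a) \<times> ('a \<times> 'a)) set" where
  "frac_rel R S =
     {((a, s), (b, t)) | a s b t.
        a \<in> carrier R \<and> s \<in> S \<and> b \<in> carrier R \<and> t \<in> S \<and>
        (\<exists>u \<in> carrier R. \<exists>v \<in> carrier R.
           a \<otimes>\<^bsub>R\<^esub> u = b \<otimes>\<^bsub>R\<^esub> v \<and> s \<otimes>\<^bsub>R\<^esub> u = t \<otimes>\<^bsub>R\<^esub> v \<and> s \<otimes>\<^bsub>R\<^esub> u \<in> S)}"

definition fraction :: "('a, 'm) ring_scheme \<Rightarrow> 'a set \<Rightarrow> 'a \<Rightarrow> 'a \<Rightarrow> ('a \<times> 'a) set" where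
  "fraction R S a s = frac_rel R S `` {(a, s)}"

lemma (in cring) frac_rel_commutative:
  assumes S: "S \<subseteq> carrier R" "\<And>s t. s \<in> S \<Longrightarrow> t \<in> S \<Longrightarrow> s \<otimes> t \<in> S"
    and nzd: "\<And>s. s \<in> S \<Longrightarrow> \<not> zero_divisor R s"
    and el: "a \<in> carrier R" "b \<in> carrier R" "s \<in> S" "t \<in> S"
  shows "((a, s), (b, t)) \<in> frac_rel R S \<longleftrightarrow> a \<otimes> t = b \<otimes> s"
proof
  assume "((a, s), (b, t)) \<in> frac_rel R S"
  then obtain u v where uv: "u \<in> carrier R" "v \<in> carrier R"
    and eq: "a \<otimes> u = b \<otimes> v" "s \<otimes> u = t \<otimes> v" and "s \<otimes> u \<in> S"
    unfolding frac_rel_def by blast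
  have c: "s \<in> carrier R" "t \<in> carrier R" using S el by auto
  have "(s \<otimes> u) \<otimes> (a \<otimes> t) = (a \<otimes> u) \<otimes> (s \<otimes> t)"
    using c el uv by (simp add: m_ac)
  also have "\<dots> = (b \<otimes> s) \<otimes> (t \<otimes> v)"
    using c el uv by (simp add: eq(1) m_ac)
  also have "\<dots> = (s \<otimes> u) \<otimes> (b \<otimes> s)"
    using c el uv by (simp add: eq(2)[symmetric] m_ac)
  finally have "(s \<otimes> u) \<otimes> (a \<otimes> t \<ominus> b \<otimes> s) = \<zero>"
    using c el uv by (simp add: a_minus_def r_distr r_minus r_neg)
  moreover have "\<not> zero_divisor R (s \<otimes> u)" using nzd \<open>s \<otimes> u \<in> S\<close> by blast
  ultimately have "a \<otimes> t \<ominus> b \<otimes> s = \<zero>"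
    using c el uv unfolding zero_divisor_def by blast
  then show "a \<otimes> t = b \<otimes> s" using c el by simp
next
  assume eq: "a \<otimes> t = b \<otimes> s"
  have c: "s \<in> carrier R" "t \<in> carrier R" using S el by auto
  have "s \<otimes> t = t \<otimes> s" "s \<otimes> t \<in> S" using c m_comm S el by auto
  then show "((a, s), (b, t)) \<in> frac_rel R S"
    using eq c el unfolding frac_rel_def by blast
qed

text \<open>
  Sums are formed over a common denominator \<open>s u = t v\<close>, where \<open>a/s = a u/(s u)\<close> and
  \<open>b/t = b v/(t v)\<close>. For products, \<open>s\<^sup>-\<^sup>1 b = c w\<^sup>-\<^sup>1\<close> whenever \<open>b w = s c\<close>, so that
  \<open>(a/s) (b/t) = a c/(t w)\<close>. The unions range over all representatives and all auxiliary
  elements; all the members of each union are the same class when \<open>S\<close> is multiplicatively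
  closed, right Ore and free of zero divisors. In a commutative ring, \<open>u = t\<close>, \<open>v = s\<close> and
  \<open>c = b\<close>, \<open>w = s\<close> give \<open>(a t + b s)/(s t)\<close> and \<open>(a b)/(t s)\<close>.
\<close>

definition frac_add ::
    "('a, 'm) ring_scheme \<Rightarrow> 'a set \<Rightarrow> ('a \<times> 'a) set \<Rightarrow> ('a \<times> 'a) set \<Rightarrow> ('a \<times> 'a) set" where
  "frac_add R S A B =
     \<Union> {fraction R S (a \<otimes>\<^bsub>R\<^esub> u \<oplus>\<^bsub>R\<^esub> b \<otimes>\<^bsub>R\<^esub> v) (s \<otimes>\<^bsub>R\<^esub> u) | a s b t u v.
          (a, s) \<in> A \<and> (b, t) \<in> B \<and> u \<in> carrier R \<and> v \<in> carrier R \<and>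
          s \<otimes>\<^bsub>R\<^esub> u = t \<otimes>\<^bsub>R\<^esub> v \<and> s \<otimes>\<^bsub>R\<^esub> u \<in> S}"

definition frac_mult ::
    "('a, 'm) ring_scheme \<Rightarrow> 'a set \<Rightarrow> ('a \<times> 'a) set \<Rightarrow> ('a \<times> 'a) set \<Rightarrow> ('a \<times> 'a) set" where
  "frac_mult R S A B =
     \<Union> {fraction R S (a \<otimes>\<^bsub>R\<^esub> c) (t \<otimes>\<^bsub>R\<^esub> w) | a s b t c w.
          (a, s) \<in> A \<and> (b, t) \<in> B \<and> c \<in> carrier R \<and> w \<in> S \<and>
          b \<otimes>\<^bsub>R\<^esub> w = s \<otimes>\<^bsub>R\<^esub> c}"

definition fractions :: "('a, 'm) ring_scheme \<Rightarrow> 'a set \<Rightarrow> ('a \<times> 'a) set ring" where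
  "fractions R S =
     \<lparr>carrier = {fraction R S a s | a s. a \<in> carrier R \<and> s \<in> S},
      monoid.mult = frac_mult R S,
      monoid.one = fraction R S \<one>\<^bsub>R\<^esub> \<one>\<^bsub>R\<^esub>,
      ring.zero = fraction R S \<zero>\<^bsub>R\<^esub> \<one>\<^bsub>R\<^esub>,
      ring.add = frac_add R S\<rparr>"

definition localization_at :: "('a, 'm) ring_scheme \<Rightarrow> 'a set \<Rightarrow> ('a \<times> 'a) set ring" where
  "localization_at R \<mm> = fractions R (carrier R - \<mm>)"

definition loc_embed :: "('a, 'm) ring_scheme \<Rightarrow> 'a set \<Rightarrow> 'a \<Rightarrow> ('a \<times> 'a) set" where
  "loc_embed R \<mm> a = fraction R (carrier R - \<mm>) a \<one>\<^bsub>R\<^esub>"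

definition extended_ideal :: "('a, 'm) ring_scheme \<Rightarrow> 'a set \<Rightarrow> ('a \<times> 'a) set set" where
  "extended_ideal R \<mm> = Idl\<^bsub>localization_at R \<mm>\<^esub> (loc_embed R \<mm> ` \<mm>)"

end

theory Submission
  imports Defs
begin

text \<open>
  Right fractions with denominators in a right Ore set \<open>S\<close> of non-zero-divisors form a ring: any
  finite family has a common denominator, and the product \<open>(a/s) (b/t)\<close> is \<open>(a c)/t\<close> as soon as
  \<open>b\<close> has the form \<open>s c\<close>, which can always be arranged by expanding \<open>b/t\<close>. Each ring axiom then
  becomes an identity of numerators.

  The section gives \<open>R = \<mm> + \<kappa>\<close> with \<open>\<kappa> \<inter> \<mm> = 0\<close>, so \<open>\<mm>\<close> is completely prime and \<open>R - \<mm>\<close> is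
  multiplicatively closed. The fractions with numerator in \<open>\<mm>\<close> form a two-sided ideal, whose
  complement consists of units. If \<open>a\<close> and \<open>s\<close> are congruent to \<open>k\<close> and \<open>l\<close> in \<open>\<kappa>\<close> modulo \<open>\<mm>\<close>,
  then \<open>a/s\<close> is congruent to \<open>k l\<^sup>-\<^sup>1\<close>.
\<close>

section \<open>The ring of fractions\<close>

locale right_Ore_set = ring R for R (structure) +
  fixes S :: "'a set"
  assumes S_subset: "S \<subseteq> carrier R"
    and one_in_S: "\<one> \<in> S"
    and mult_in_S: "\<lbrakk>s \<in> S; t \<in> S\<rbrakk> \<Longrightarrow> s \<otimes> t \<in> S"
    and regular: "s \<in> S \<Longrightarrow> \<not> zero_divisor R s"
    and Ore: "right_Ore R S"
begin

abbreviation "rfrac \<equiv> fraction R S"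
abbreviation "Q \<equiv> fractions R S"

section \<open>Cancellation and equality of fractions\<close>

lemma S_carrier [simp]: "s \<in> S \<Longrightarrow> s \<in> carrier R"
  using S_subset by blast

lemma OreE:
  assumes "a \<in> carrier R" "s \<in> S"
  obtains b t where "b \<in> carrier R" "t \<in> S" "a \<otimes> t = s \<otimes> b"
  using Ore assms unfolding right_Ore_def by blast

lemma S_cancel_left:
  assumes "s \<in> S" "x \<in> carrier R" "y \<in> carrier R" "s \<otimes> x = s \<otimes> y"
  shows "x = y"
proof -
  have "s \<otimes> (x \<ominus> y) = \<zero>"
    using assms by (simp add: a_minus_def r_distr r_minus r_neg)
  then have "x \<ominus> y = \<zero>"
    using regular[OF assms(1)] assms unfolding zero_divisor_def by auto
  then show ?thesis using assms by simp
qed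

lemma S_cancel_right:
  assumes "s \<in> S" "x \<in> carrier R" "y \<in> carrier R" "x \<otimes> s = y \<otimes> s"
  shows "x = y"
proof -
  have "(x \<ominus> y) \<otimes> s = \<zero>"
    using assms by (simp add: a_minus_def l_distr l_minus r_neg)
  then have "x \<ominus> y = \<zero>"
    using regular[OF assms(1)] assms unfolding zero_divisor_def by auto
  then show ?thesis using assms by simp
qed

text \<open>
  Equal fractions agree as partial maps \<open>s u \<mapsto> a u\<close> on right ideals, even where the common value
  \<open>s u = t v\<close> is not in \<open>S\<close>; this generality is what products need.
\<close>

lemma frac_relD:
  assumes "((a, s), (b, t)) \<in> frac_rel R S"
    and "u \<in> carrier R" "v \<in> carrier R" "s \<otimes> u = t \<otimes> v"
  shows "a \<otimes> u = b \<otimes> v"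
proof -
  obtain p q where c: "a \<in> carrier R" "s \<in> S" "b \<in> carrier R" "t \<in> S"
    and pq: "p \<in> carrier R" "q \<in> carrier R" "a \<otimes> p = b \<otimes> q" "s \<otimes> p = t \<otimes> q" "s \<otimes> p \<in> S"
    using assms(1) unfolding frac_rel_def by blast
  \<comment> \<open>The Ore condition compares \<open>s \<otimes> u\<close> with
    \<open>s \<otimes> p\<close>, the common value at which the relation is known. The multiplier
    \<open>w\<close> on the side of \<open>u\<close> lies in \<open>S\<close>, so it can be
    cancelled on the right at the end; cancelling \<open>s\<close> and \<open>t\<close> on the left
    turns the one equation into \<open>u \<otimes> w = p \<otimes> y\<close> and
    \<open>v \<otimes> w = q \<otimes> y\<close>.\<close>
  obtain y w where yw: "y \<in> carrier R" "w \<in> S" "(s \<otimes> u) \<otimes> w = (s \<otimes> p) \<otimes> y"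
    using OreE[of "s \<otimes> u" "s \<otimes> p"] c pq assms by auto
  have "s \<otimes> (u \<otimes> w) = s \<otimes> (p \<otimes> y)"
    using yw c(2) pq(1) assms(2) by (simp add: m_assoc)
  then have uw: "u \<otimes> w = p \<otimes> y"
    using S_cancel_left[OF c(2)] yw pq assms by simp
  have "t \<otimes> (v \<otimes> w) = t \<otimes> (q \<otimes> y)"
    using yw c pq assms by (simp flip: m_assoc)
  then have vw: "v \<otimes> w = q \<otimes> y"
    using S_cancel_left[OF c(4)] yw pq assms by simp
  have "(a \<otimes> u) \<otimes> w = a \<otimes> (p \<otimes> y)"
    using yw c assms uw by (simp add: m_assoc)
  also have "\<dots> = b \<otimes> (q \<otimes> y)"
    using yw c pq by (simp flip: m_assoc)
  also have "\<dots> = (b \<otimes> v) \<otimes> w"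
    using yw c assms vw by (simp add: m_assoc)
  finally show ?thesis
    using S_cancel_right[OF yw(2)] c assms by simp
qed

lemma frac_relI:
  assumes "a \<in> carrier R" "s \<in> S" "b \<in> carrier R" "t \<in> S" "u \<in> carrier R" "v \<in> carrier R"
    and "a \<otimes> u = b \<otimes> v" "s \<otimes> u = t \<otimes> v" "s \<otimes> u \<in> S"
  shows "((a, s), (b, t)) \<in> frac_rel R S"
  using assms unfolding frac_rel_def by blast

text \<open>The Ore condition for the pair of denominators supplies a multiplier \<open>u\<close> in
  \<open>S\<close>, which forces the common value \<open>s \<otimes> u\<close> into
  \<open>S\<close>; the other multiplier \<open>v\<close> is only an element of the ring.\<close>

lemma common_multiple:
  assumes "s \<in> S" "t \<in> S"
  obtains u v where "u \<in> carrier R" "v \<in> carrier R" "s \<otimes> u = t \<otimes> v" "s \<otimes> u \<in> S"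
proof -
  obtain v u where "v \<in> carrier R" "u \<in> S" "s \<otimes> u = t \<otimes> v"
    using OreE[of s t] assms by auto
  then show ?thesis using that[of u v] assms mult_in_S[of s u] S_carrier by blast
qed

lemma frac_rel_equiv: "equiv (carrier R \<times> S) (frac_rel R S)"
proof (rule equivI)
  show "frac_rel R S \<subseteq> (carrier R \<times> S) \<times> (carrier R \<times> S)"
    unfolding frac_rel_def by blast
  show "refl_on (carrier R \<times> S) (frac_rel R S)"
    by (rule refl_onI) (auto intro!: frac_relI[where u = \<one> and v = \<one>])
  show "sym (frac_rel R S)"
    by (rule symI) (auto simp: frac_rel_def, metis)
  show "trans (frac_rel R S)"
  proof (rule transI)
    fix x y z assume xy: "(x, y) \<in> frac_rel R S" and yz: "(y, z) \<in> frac_rel R S"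
    obtain a s where x: "x = (a, s)" by (cases x)
    obtain b t where y: "y = (b, t)" by (cases y)
    obtain c r where z: "z = (c, r)" by (cases z)
    have car: "a \<in> carrier R" "s \<in> S" "b \<in> carrier R" "t \<in> S" "c \<in> carrier R" "r \<in> S"
      using xy yz unfolding x y z frac_rel_def by auto
    obtain p q where pq: "p \<in> carrier R" "q \<in> carrier R" "s \<otimes> p = t \<otimes> q" "s \<otimes> p \<in> S"
      using common_multiple[of s t] car by blast
    \<comment> \<open>A common value of \<open>s\<close> and \<open>t\<close> is multiplied by some
      \<open>w\<close> in \<open>S\<close> until it is also a value of \<open>r\<close>. All three
      numerators are then compared there, with \<open>b \<otimes> (q \<otimes> w)\<close> as the
      middle term, and the value stays in \<open>S\<close>.\<close>
    obtain w v where wv: "v \<in> carrier R" "w \<in> S" "(s \<otimes> p) \<otimes> w = r \<otimes> v"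
      using OreE[of "s \<otimes> p" r] car pq by (metis S_carrier)
    have sp: "s \<otimes> (p \<otimes> w) = t \<otimes> (q \<otimes> w)" "t \<otimes> (q \<otimes> w) = r \<otimes> v"
      using car pq wv by (simp_all flip: m_assoc)
    have "a \<otimes> (p \<otimes> w) = c \<otimes> v"
      using frac_relD[OF xy[unfolded x y] _ _ sp(1)] frac_relD[OF yz[unfolded y z] _ _ sp(2)]
        car pq wv by simp
    moreover have "s \<otimes> (p \<otimes> w) \<in> S"
      using mult_in_S[OF pq(4) wv(2)] car(2) pq(1) wv(2) by (simp add: m_assoc)
    ultimately show "(x, z) \<in> frac_rel R S"
      unfolding x z using frac_relI[of a s c r "p \<otimes> w" v] car pq wv sp by simp
  qed
qed

lemma frac_eq_iff:
  assumes "a \<in> carrier R" "s \<in> S" "b \<in> carrier R" "t \<in> S"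
  shows "rfrac a s = rfrac b t \<longleftrightarrow> ((a, s), (b, t)) \<in> frac_rel R S"
  unfolding fraction_def using assms by (intro eq_equiv_class_iff[OF frac_rel_equiv]) auto

lemma frac_eqI:
  assumes "a \<in> carrier R" "s \<in> S" "b \<in> carrier R" "t \<in> S" "u \<in> carrier R" "v \<in> carrier R"
    and "a \<otimes> u = b \<otimes> v" "s \<otimes> u = t \<otimes> v" "s \<otimes> u \<in> S"
  shows "rfrac a s = rfrac b t"
  using assms by (simp add: frac_eq_iff frac_relI)

lemma frac_eqD:
  assumes "rfrac a s = rfrac b t" "a \<in> carrier R" "s \<in> S" "b \<in> carrier R" "t \<in> S"
    and "u \<in> carrier R" "v \<in> carrier R" "s \<otimes> u = t \<otimes> v"
  shows "a \<otimes> u = b \<otimes> v"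
  using assms frac_relD by (simp add: frac_eq_iff)

text \<open>Turns the choice of representatives in the unions of \<open>frac_add\<close> and
  \<open>frac_mult\<close> into equations between classes.\<close>

lemma in_frac_iff:
  assumes "a \<in> carrier R" "s \<in> S"
  shows "(b, t) \<in> rfrac a s \<longleftrightarrow> b \<in> carrier R \<and> t \<in> S \<and> rfrac a s = rfrac b t"
proof -
  have "(b, t) \<in> rfrac a s \<longleftrightarrow> ((a, s), (b, t)) \<in> frac_rel R S"
    by (simp add: fraction_def)
  moreover have "b \<in> carrier R \<and> t \<in> S" if "((a, s), (b, t)) \<in> frac_rel R S"
    using that unfolding frac_rel_def by blast
  ultimately show ?thesis using frac_eq_iff assms by blast
qed

text \<open>The factor \<open>u\<close> itself may lie outside \<open>S\<close>; only the new
  denominator must be in \<open>S\<close>. This is the form in which the Ore condition delivers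
  expansions.\<close>

lemma frac_expand:
  assumes "a \<in> carrier R" "s \<in> S" "u \<in> carrier R" "s \<otimes> u \<in> S"
  shows "rfrac (a \<otimes> u) (s \<otimes> u) = rfrac a s"
  using assms by (intro frac_eqI[where u = \<one> and v = u]) auto

lemma frac_numerator_inj:
  assumes "a \<in> carrier R" "b \<in> carrier R" "s \<in> S" "rfrac a s = rfrac b s"
  shows "a = b"
  using frac_eqD[OF assms(4), of \<one> \<one>] assms by simp

section \<open>Sums and products on representatives\<close>

lemma carrier_Q: "carrier Q = {rfrac a s | a s. a \<in> carrier R \<and> s \<in> S}"
  by (simp add: fractions_def)

lemma frac_closed [simp]: "\<lbrakk>a \<in> carrier R; s \<in> S\<rbrakk> \<Longrightarrow> rfrac a s \<in> carrier Q"
  by (auto simp: carrier_Q)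

lemma carrier_QE:
  assumes "A \<in> carrier Q"
  obtains a s where "a \<in> carrier R" "s \<in> S" "A = rfrac a s"
  using assms by (auto simp: carrier_Q)

lemma frac_add_well_defined:
  assumes "a \<in> carrier R" "b \<in> carrier R" "s \<in> S" "a' \<in> carrier R" "b' \<in> carrier R" "s' \<in> S"
    and eq: "rfrac a s = rfrac a' s'" "rfrac b s = rfrac b' s'"
  shows "rfrac (a \<oplus> b) s = rfrac (a' \<oplus> b') s'"
proof -
  obtain u v where uv: "u \<in> carrier R" "v \<in> carrier R" "s \<otimes> u = s' \<otimes> v" "s \<otimes> u \<in> S"
    using common_multiple[of s s'] assms by blast
  have "a \<otimes> u = a' \<otimes> v" "b \<otimes> u = b' \<otimes> v"
    using frac_eqD[OF eq(1), of u v] frac_eqD[OF eq(2), of u v] assms uv by auto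
  then show ?thesis
    using assms uv by (intro frac_eqI[of _ _ _ _ u v]) (auto simp: l_distr)
qed

lemma frac_mult_well_defined:
  assumes "a \<in> carrier R" "s \<in> S" "c \<in> carrier R" "t \<in> S"
    and "a' \<in> carrier R" "s' \<in> S" "c' \<in> carrier R" "t' \<in> S"
    and eq: "rfrac a s = rfrac a' s'" "rfrac (s \<otimes> c) t = rfrac (s' \<otimes> c') t'"
  shows "rfrac (a \<otimes> c) t = rfrac (a' \<otimes> c') t'"
proof -
  obtain u v where uv: "u \<in> carrier R" "v \<in> carrier R" "t \<otimes> u = t' \<otimes> v" "t \<otimes> u \<in> S"
    using common_multiple[of t t'] assms by blast
  \<comment> \<open>This common value of \<open>s\<close> and \<open>s'\<close> need not lie in
    \<open>S\<close>, because \<open>c\<close> is arbitrary. The equality of the first factors can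
    still be evaluated at it, by the general form of \<open>frac_relD\<close>.\<close>
  have "s \<otimes> (c \<otimes> u) = s' \<otimes> (c' \<otimes> v)"
    using frac_eqD[OF eq(2), of u v] assms uv by (simp add: m_assoc)
  then have "a \<otimes> (c \<otimes> u) = a' \<otimes> (c' \<otimes> v)"
    using frac_eqD[OF eq(1), of "c \<otimes> u" "c' \<otimes> v"] assms uv by simp
  then show ?thesis
    using assms uv by (intro frac_eqI[of _ _ _ _ u v]) (auto simp: m_assoc)
qed

lemma frac_add_eq:
  assumes "a \<in> carrier R" "b \<in> carrier R" "s \<in> S"
  shows "rfrac a s \<oplus>\<^bsub>Q\<^esub> rfrac b s = rfrac (a \<oplus> b) s"
proof -
  let ?F = "{rfrac (a' \<otimes> u \<oplus> b' \<otimes> v) (s' \<otimes> u) | a' s' b' t' u v.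
      (a', s') \<in> rfrac a s \<and> (b', t') \<in> rfrac b s \<and> u \<in> carrier R \<and> v \<in> carrier R \<and>
      s' \<otimes> u = t' \<otimes> v \<and> s' \<otimes> u \<in> S}"
  have same: "rfrac (a' \<otimes> u \<oplus> b' \<otimes> v) (s' \<otimes> u) = rfrac (a \<oplus> b) s"
    if "(a', s') \<in> rfrac a s" "(b', t') \<in> rfrac b s" "u \<in> carrier R" "v \<in> carrier R"
      "s' \<otimes> u = t' \<otimes> v" "s' \<otimes> u \<in> S" for a' s' b' t' u v
  proof -
    have c: "a' \<in> carrier R" "s' \<in> S" "b' \<in> carrier R" "t' \<in> S"
      and e: "rfrac a s = rfrac a' s'" "rfrac b s = rfrac b' t'"
      using that assms by (auto simp: in_frac_iff)
    have "rfrac (a' \<otimes> u) (s' \<otimes> u) = rfrac a s" "rfrac (b' \<otimes> v) (s' \<otimes> u) = rfrac b s"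
      using frac_expand[of a' s' u] frac_expand[of b' t' v] c e that by auto
    then show ?thesis
      using assms c that by (intro frac_add_well_defined) auto
  qed
  \<comment> \<open>The trivial choice \<open>u = v = \<one>\<close> shows that the family is
    nonempty, so its union is the common class rather than the empty set.\<close>
  have mem: "rfrac (a \<otimes> \<one> \<oplus> b \<otimes> \<one>) (s \<otimes> \<one>) \<in> ?F"
  proof -
    have "(a, s) \<in> rfrac a s" "(b, s) \<in> rfrac b s" "s \<otimes> \<one> \<in> S"
      using assms by (simp_all add: in_frac_iff)
    then show ?thesis by (intro CollectI exI conjI) (rule refl | assumption | simp)+
  qed
  have "?F = {rfrac (a \<oplus> b) s}"
  proof (intro equalityI subsetI)
    fix A assume "A \<in> ?F"
    then show "A \<in> {rfrac (a \<oplus> b) s}"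
      by (elim CollectE exE conjE) (unfold singleton_iff, erule trans, rule same)
  qed (use mem assms in simp)
  then show ?thesis by (simp add: fractions_def frac_add_def)
qed

text \<open>Once the second numerator has the form \<open>s \<otimes> c\<close>, the inner factor
  \<open>s\<close> cancels against the first denominator, and the product is computed without a
  further use of the Ore condition.\<close>

lemma frac_mult_eq:
  assumes "a \<in> carrier R" "s \<in> S" "c \<in> carrier R" "t \<in> S"
  shows "rfrac a s \<otimes>\<^bsub>Q\<^esub> rfrac (s \<otimes> c) t = rfrac (a \<otimes> c) t"
proof -
  let ?F = "{rfrac (a' \<otimes> c') (t' \<otimes> w) | a' s' b' t' c' w.
      (a', s') \<in> rfrac a s \<and> (b', t') \<in> rfrac (s \<otimes> c) t \<and> c' \<in> carrier R \<and> w \<in> S \<and>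
      b' \<otimes> w = s' \<otimes> c'}"
  have same: "rfrac (a' \<otimes> c') (t' \<otimes> w) = rfrac (a \<otimes> c) t"
    if "(a', s') \<in> rfrac a s" "(b', t') \<in> rfrac (s \<otimes> c) t" "c' \<in> carrier R" "w \<in> S"
      "b' \<otimes> w = s' \<otimes> c'" for a' s' b' t' c' w
  proof -
    have c: "a' \<in> carrier R" "s' \<in> S" "b' \<in> carrier R" "t' \<in> S"
      and e: "rfrac a s = rfrac a' s'" "rfrac (s \<otimes> c) t = rfrac b' t'"
      using that assms by (auto simp: in_frac_iff)
    have "rfrac (s' \<otimes> c') (t' \<otimes> w) = rfrac (s \<otimes> c) t"
      using frac_expand[of b' t' w] c e that mult_in_S by auto
    then show ?thesis
      using assms c e that mult_in_S by (intro frac_mult_well_defined[of a' s' _ _ a s]) auto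
  qed
  have mem: "rfrac (a \<otimes> c) (t \<otimes> \<one>) \<in> ?F"
  proof -
    have "(a, s) \<in> rfrac a s" "(s \<otimes> c, t) \<in> rfrac (s \<otimes> c) t" "(s \<otimes> c) \<otimes> \<one> = s \<otimes> c"
      using assms by (simp_all add: in_frac_iff)
    then show ?thesis
      by (intro CollectI exI conjI) (rule refl | assumption | rule one_in_S | rule assms(3))+
  qed
  have "?F = {rfrac (a \<otimes> c) t}"
  proof (intro equalityI subsetI)
    fix A assume "A \<in> ?F"
    then show "A \<in> {rfrac (a \<otimes> c) t}"
      by (elim CollectE exE conjE) (unfold singleton_iff, erule trans, rule same)
  qed (use mem assms in simp)
  then show ?thesis by (simp add: fractions_def frac_mult_def)
qed

lemma one_Q: "\<one>\<^bsub>Q\<^esub> = rfrac \<one> \<one>"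
  by (simp add: fractions_def)

lemma zero_Q: "\<zero>\<^bsub>Q\<^esub> = rfrac \<zero> \<one>"
  by (simp add: fractions_def)

lemma frac_self: "s \<in> S \<Longrightarrow> rfrac s s = \<one>\<^bsub>Q\<^esub>"
  using frac_expand[of \<one> \<one> s] one_in_S by (simp add: one_Q)

lemma frac_zero: "s \<in> S \<Longrightarrow> rfrac \<zero> s = \<zero>\<^bsub>Q\<^esub>"
  using frac_expand[of \<zero> \<one> s] one_in_S by (simp add: zero_Q)

section \<open>Common denominators and adapted numerators\<close>

lemma common_denominator:
  assumes "A \<in> carrier Q" "s \<in> S"
  obtains a v where "a \<in> carrier R" "v \<in> S" "s \<otimes> v \<in> S" "A = rfrac a (s \<otimes> v)"
proof -
  obtain a t where a: "a \<in> carrier R" "t \<in> S" "A = rfrac a t"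
    using assms carrier_QE by blast
  \<comment> \<open>The new denominator keeps the prescribed \<open>s\<close> as its left factor, so
    fractions already over \<open>s\<close> can be expanded to it. This allows the construction to
    be iterated for two and three fractions.\<close>
  obtain u v where uv: "u \<in> carrier R" "v \<in> S" "s \<otimes> v = t \<otimes> u"
    using OreE[of s t] a assms by auto
  have tu: "t \<otimes> u \<in> S" using mult_in_S[OF assms(2) uv(2)] uv(3) by simp
  have "A = rfrac (a \<otimes> u) (s \<otimes> v)"
    using frac_expand[OF a(1,2) uv(1) tu] a(3) uv(3) by simp
  then show ?thesis using that[of "a \<otimes> u" v] a uv tu by simp
qed

lemma common_denominator_2:
  assumes "A \<in> carrier Q" "B \<in> carrier Q"
  obtains a b s where "a \<in> carrier R" "b \<in> carrier R" "s \<in> S" "A = rfrac a s" "B = rfrac b s"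
proof -
  obtain a s where a: "a \<in> carrier R" "s \<in> S" "A = rfrac a s"
    using assms carrier_QE by blast
  obtain b v where b: "b \<in> carrier R" "v \<in> S" "s \<otimes> v \<in> S" "B = rfrac b (s \<otimes> v)"
    using common_denominator[OF assms(2) a(2)] .
  have "A = rfrac (a \<otimes> v) (s \<otimes> v)"
    using frac_expand[of a s v] a b by simp
  then show ?thesis using that[of "a \<otimes> v" b "s \<otimes> v"] a b by simp
qed

lemma common_denominator_3:
  assumes "A \<in> carrier Q" "B \<in> carrier Q" "C \<in> carrier Q"
  obtains a b c s where "a \<in> carrier R" "b \<in> carrier R" "c \<in> carrier R" "s \<in> S"
    "A = rfrac a s" "B = rfrac b s" "C = rfrac c s"
proof -
  obtain a b s where a: "a \<in> carrier R" "b \<in> carrier R" "s \<in> S" "A = rfrac a s" "B = rfrac b s"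
    using assms common_denominator_2 by metis
  obtain c v where c: "c \<in> carrier R" "v \<in> S" "s \<otimes> v \<in> S" "C = rfrac c (s \<otimes> v)"
    using common_denominator[OF assms(3) a(3)] .
  have "A = rfrac (a \<otimes> v) (s \<otimes> v)" "B = rfrac (b \<otimes> v) (s \<otimes> v)"
    using frac_expand[of a s v] frac_expand[of b s v] a c by simp_all
  then show ?thesis using that[of "a \<otimes> v" "b \<otimes> v" c "s \<otimes> v"] a c by simp
qed

text \<open>Prepares a right factor for multiplication by a fraction with denominator
  \<open>s\<close>, in the form that \<open>frac_mult_eq\<close> expects.\<close>

lemma numerator_multiple:
  assumes "B \<in> carrier Q" "s \<in> S"
  obtains c t where "c \<in> carrier R" "t \<in> S" "B = rfrac (s \<otimes> c) t"
proof -
  obtain b t where b: "b \<in> carrier R" "t \<in> S" "B = rfrac b t"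
    using assms carrier_QE by blast
  obtain c w where c: "c \<in> carrier R" "w \<in> S" "b \<otimes> w = s \<otimes> c"
    using OreE[of b s] b assms by auto
  have "B = rfrac (s \<otimes> c) (t \<otimes> w)"
    using frac_expand[of b t w] b c mult_in_S by simp
  then show ?thesis using that[of c "t \<otimes> w"] b c mult_in_S by simp
qed

lemma numerator_multiple_2:
  assumes "A \<in> carrier Q" "B \<in> carrier Q" "s \<in> S"
  obtains c d t where "c \<in> carrier R" "d \<in> carrier R" "t \<in> S"
    "A = rfrac (s \<otimes> c) t" "B = rfrac (s \<otimes> d) t"
proof -
  obtain a b t where a: "a \<in> carrier R" "b \<in> carrier R" "t \<in> S" "A = rfrac a t" "B = rfrac b t"
    using assms common_denominator_2 by metis
  obtain c w where c: "c \<in> carrier R" "w \<in> S" "a \<otimes> w = s \<otimes> c"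
    using OreE[of a s] a assms by auto
  \<comment> \<open>The second use of the Ore condition starts from \<open>b \<otimes> w\<close>, so
    the single factor \<open>w \<otimes> v\<close> brings both numerators into the form
    \<open>s\<close> times an element.\<close>
  obtain d v where d: "d \<in> carrier R" "v \<in> S" "(b \<otimes> w) \<otimes> v = s \<otimes> d"
    using OreE[of "b \<otimes> w" s] a c assms by auto
  have "w \<otimes> v \<in> S" "t \<otimes> (w \<otimes> v) \<in> S" using a c d mult_in_S by auto
  moreover have "a \<otimes> (w \<otimes> v) = s \<otimes> (c \<otimes> v)"
  proof -
    have "a \<otimes> (w \<otimes> v) = (a \<otimes> w) \<otimes> v" using a(1) c(2) d(2) by (simp add: m_assoc)
    then show ?thesis using assms c d by (simp add: m_assoc)
  qed
  moreover have "b \<otimes> (w \<otimes> v) = s \<otimes> d" using a c d by (simp add: m_assoc)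
  ultimately show ?thesis
    using that[of "c \<otimes> v" d "t \<otimes> (w \<otimes> v)"] frac_expand[of a t "w \<otimes> v"] frac_expand[of b t "w \<otimes> v"]
      a c d by simp
qed

lemma ring_Q: "ring Q"
proof (rule ringI)
  show "abelian_group Q"
  proof (rule abelian_groupI)
    fix A B assume "A \<in> carrier Q" "B \<in> carrier Q"
    then obtain a b s where "a \<in> carrier R" "b \<in> carrier R" "s \<in> S" "A = rfrac a s" "B = rfrac b s"
      by (rule common_denominator_2)
    then show "A \<oplus>\<^bsub>Q\<^esub> B \<in> carrier Q" "A \<oplus>\<^bsub>Q\<^esub> B = B \<oplus>\<^bsub>Q\<^esub> A"
      by (simp_all add: frac_add_eq a_comm)
  next
    show "\<zero>\<^bsub>Q\<^esub> \<in> carrier Q" by (simp add: zero_Q one_in_S)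
  next
    fix A B C assume "A \<in> carrier Q" "B \<in> carrier Q" "C \<in> carrier Q"
    then obtain a b c s where "a \<in> carrier R" "b \<in> carrier R" "c \<in> carrier R" "s \<in> S"
      "A = rfrac a s" "B = rfrac b s" "C = rfrac c s"
      by (rule common_denominator_3)
    then show "A \<oplus>\<^bsub>Q\<^esub> B \<oplus>\<^bsub>Q\<^esub> C = A \<oplus>\<^bsub>Q\<^esub> (B \<oplus>\<^bsub>Q\<^esub> C)"
      by (simp add: frac_add_eq a_assoc)
  next
    fix A assume "A \<in> carrier Q"
    then obtain a s where a: "a \<in> carrier R" "s \<in> S" "A = rfrac a s"
      by (rule carrier_QE)
    then show "\<zero>\<^bsub>Q\<^esub> \<oplus>\<^bsub>Q\<^esub> A = A"
      using frac_add_eq[of \<zero> a s] by (simp add: frac_zero)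
    have "rfrac (\<ominus> a) s \<oplus>\<^bsub>Q\<^esub> A = \<zero>\<^bsub>Q\<^esub>"
      using a by (simp add: frac_add_eq l_neg frac_zero)
    then show "\<exists>B \<in> carrier Q. B \<oplus>\<^bsub>Q\<^esub> A = \<zero>\<^bsub>Q\<^esub>"
      using a by (intro bexI) auto
  qed
  show "monoid Q"
  proof (rule monoidI)
    fix A B assume "A \<in> carrier Q" "B \<in> carrier Q"
    then obtain a s c t where "a \<in> carrier R" "s \<in> S" "A = rfrac a s"
      "c \<in> carrier R" "t \<in> S" "B = rfrac (s \<otimes> c) t"
      by (metis carrier_QE numerator_multiple)
    then show "A \<otimes>\<^bsub>Q\<^esub> B \<in> carrier Q" by (simp add: frac_mult_eq)
  next
    show "\<one>\<^bsub>Q\<^esub> \<in> carrier Q" by (simp add: one_Q one_in_S)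
  next
    fix A B C assume "A \<in> carrier Q" "B \<in> carrier Q" "C \<in> carrier Q"
    \<comment> \<open>The representatives are chained: each numerator begins with the denominator of
      the preceding factor. Both bracketings then have numerator
      \<open>a \<otimes> b \<otimes> c\<close> and denominator \<open>r\<close>.\<close>
    then obtain a s b t c r where el: "a \<in> carrier R" "s \<in> S" "b \<in> carrier R" "t \<in> S"
      "c \<in> carrier R" "r \<in> S"
      and ABC: "A = rfrac a s" "B = rfrac (s \<otimes> b) t" "C = rfrac (t \<otimes> c) r"
      by (metis carrier_QE numerator_multiple)
    have "B \<otimes>\<^bsub>Q\<^esub> C = rfrac (s \<otimes> (b \<otimes> c)) r"
      using el ABC by (simp add: frac_mult_eq m_assoc)
    then show "A \<otimes>\<^bsub>Q\<^esub> B \<otimes>\<^bsub>Q\<^esub> C = A \<otimes>\<^bsub>Q\<^esub> (B \<otimes>\<^bsub>Q\<^esub> C)"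
      using el ABC by (simp add: frac_mult_eq m_assoc)
  next
    fix A assume "A \<in> carrier Q"
    then obtain a s where a: "a \<in> carrier R" "s \<in> S" "A = rfrac a s"
      by (rule carrier_QE)
    show "\<one>\<^bsub>Q\<^esub> \<otimes>\<^bsub>Q\<^esub> A = A"
      using frac_mult_eq[of \<one> \<one> a s] a one_in_S by (simp add: one_Q)
    show "A \<otimes>\<^bsub>Q\<^esub> \<one>\<^bsub>Q\<^esub> = A"
      using frac_mult_eq[of a s \<one> s] a one_in_S by (simp add: frac_self)
  qed
  fix A B C assume C: "A \<in> carrier Q" "B \<in> carrier Q" "C \<in> carrier Q"
  obtain a b s where a: "a \<in> carrier R" "b \<in> carrier R" "s \<in> S" "A = rfrac a s" "B = rfrac b s"
    using C common_denominator_2 by metis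
  obtain c t where "c \<in> carrier R" "t \<in> S" "C = rfrac (s \<otimes> c) t"
    using numerator_multiple C(3) a(3) by blast
  with a show "(A \<oplus>\<^bsub>Q\<^esub> B) \<otimes>\<^bsub>Q\<^esub> C = A \<otimes>\<^bsub>Q\<^esub> C \<oplus>\<^bsub>Q\<^esub> B \<otimes>\<^bsub>Q\<^esub> C"
    by (simp add: frac_add_eq frac_mult_eq l_distr)
  \<comment> \<open>For a sum in the right factor the roles change: the left factor \<open>C\<close>
    fixes \<open>s\<close>, and both summands need numerators beginning with \<open>s\<close> over
    one denominator.\<close>
  obtain c s where c: "c \<in> carrier R" "s \<in> S" "C = rfrac c s"
    using C(3) carrier_QE by blast
  obtain a b t where "a \<in> carrier R" "b \<in> carrier R" "t \<in> S"
    "A = rfrac (s \<otimes> a) t" "B = rfrac (s \<otimes> b) t"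
    using numerator_multiple_2 C c by metis
  moreover from this have "A \<oplus>\<^bsub>Q\<^esub> B = rfrac (s \<otimes> (a \<oplus> b)) t"
    using c by (simp add: frac_add_eq r_distr)
  moreover from calculation have "C \<otimes>\<^bsub>Q\<^esub> (A \<oplus>\<^bsub>Q\<^esub> B) = rfrac (c \<otimes> (a \<oplus> b)) t"
    using c by (simp add: frac_mult_eq del: r_distr)
  ultimately show "C \<otimes>\<^bsub>Q\<^esub> (A \<oplus>\<^bsub>Q\<^esub> B) = C \<otimes>\<^bsub>Q\<^esub> A \<oplus>\<^bsub>Q\<^esub> C \<otimes>\<^bsub>Q\<^esub> B"
    using c by (simp add: frac_add_eq frac_mult_eq r_distr)
qed

section \<open>The embedding of the base ring and the units among fractions\<close>

lemma frac_one_ring_hom: "(\<lambda>a. rfrac a \<one>) \<in> ring_hom R Q"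
proof (rule ring_hom_memI)
  fix a b assume "a \<in> carrier R" "b \<in> carrier R"
  then show "rfrac (a \<otimes> b) \<one> = rfrac a \<one> \<otimes>\<^bsub>Q\<^esub> rfrac b \<one>"
    using frac_mult_eq[of a \<one> b \<one>] one_in_S by simp
qed (simp_all add: frac_add_eq one_in_S one_Q)

lemma frac_one_inj: "inj_on (\<lambda>a. rfrac a \<one>) (carrier R)"
  by (rule inj_onI) (use frac_numerator_inj one_in_S in blast)

lemma frac_mult_inverse:
  assumes "s \<in> S" "t \<in> S"
  shows "rfrac s t \<otimes>\<^bsub>Q\<^esub> rfrac t s = \<one>\<^bsub>Q\<^esub>"
  using frac_mult_eq[of s t \<one> s] assms by (simp add: frac_self)

lemma frac_Units: "\<lbrakk>s \<in> S; t \<in> S\<rbrakk> \<Longrightarrow> rfrac s t \<in> Units Q"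
  using frac_mult_inverse[of s t] frac_mult_inverse[of t s] unfolding Units_def by auto

lemma frac_decompose:
  assumes "a \<in> carrier R" "s \<in> S"
  shows "rfrac a s = rfrac a \<one> \<otimes>\<^bsub>Q\<^esub> rfrac \<one> s"
  using frac_mult_eq[of a \<one> \<one> s] one_in_S assms by simp

end

section \<open>Sections of residue fields\<close>

text \<open>The composite of \<open>h\<close> with the projection is injective, since
  \<open>K\<close> is a field and \<open>M\<close> is proper, and the covering hypothesis makes it
  onto; its inverse is the required \<open>j\<close>. Using a homomorphism \<open>h\<close> instead
  of an inclusion covers both a subfield of \<open>T\<close> and a field embedded from another
  ring.\<close>

lemma section_ring_iso:
  assumes "ring T" "field K" "ideal M T" "M \<noteq> carrier T" "h \<in> ring_hom K T"
    and cover: "\<And>x. x \<in> carrier T \<Longrightarrow> \<exists>k \<in> carrier K. x \<ominus>\<^bsub>T\<^esub> h k \<in> M"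
  shows "\<exists>j \<in> ring_iso (T Quot M) K. \<forall>C \<in> carrier (T Quot M). M +>\<^bsub>T\<^esub> h (j C) = C"
proof -
  interpret T: ring T by fact
  interpret K: field K by fact
  interpret M: ideal M T by fact
  interpret Quot: ring "T Quot M" by (rule M.quotient_is_ring)
  let ?g = "\<lambda>k. M +>\<^bsub>T\<^esub> h k"
  have hK: "h k \<in> carrier T" if "k \<in> carrier K" for k
    using ring_hom_closed[OF assms(5) that] .
  have g_hom: "?g \<in> ring_hom K (T Quot M)"
    using ring_hom_trans[OF assms(5) M.rcos_ring_hom] by (simp add: comp_def)
  interpret g: ring_hom_ring K "T Quot M" ?g
    by (rule ring_hom_ringI2[OF K.ring_axioms Quot.ring_axioms g_hom])
  have "?g \<one>\<^bsub>K\<^esub> \<noteq> \<zero>\<^bsub>T Quot M\<^esub>"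
  proof
    assume "?g \<one>\<^bsub>K\<^esub> = \<zero>\<^bsub>T Quot M\<^esub>"
    then have "M +>\<^bsub>T\<^esub> \<one>\<^bsub>T\<^esub> = M"
      using ring_hom_one[OF assms(5)] by (simp add: FactRing_def)
    then have "\<one>\<^bsub>T\<^esub> \<in> M" by (rule M.rcos_const_imp_mem[OF T.one_closed])
    then show False using M.one_imp_carrier assms(4) by blast
  qed
  then have "?g ` carrier K \<noteq> {\<zero>\<^bsub>T Quot M\<^esub>}" using K.one_closed by blast
  then have g_inj: "inj_on ?g (carrier K)"
    by (rule g.non_trivial_field_hom_imp_inj[OF K.field_axioms])
  have "C \<in> ?g ` carrier K" if C: "C \<in> carrier (T Quot M)" for C
  proof -
    obtain x where x: "x \<in> carrier T" "C = M +>\<^bsub>T\<^esub> x"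
      using C by (auto simp: FactRing_simps)
    obtain k where k: "k \<in> carrier K" "x \<ominus>\<^bsub>T\<^esub> h k \<in> M"
      using cover x(1) by blast
    have "C = ?g k"
      using T.quotient_eq_iff_same_a_r_cos[OF M.is_ideal x(1) hK[OF k(1)]] k x by simp
    then show ?thesis using k(1) by blast
  qed
  then have g_surj: "?g ` carrier K = carrier (T Quot M)"
    using g.hom_closed by blast
  have g_iso: "?g \<in> ring_iso K (T Quot M)"
    using g_hom g_inj g_surj by (simp add: ring_iso_def bij_betw_def)
  show ?thesis
  proof (intro bexI ballI)
    show "inv_into (carrier K) ?g \<in> ring_iso (T Quot M) K"
      by (rule ring_iso_set_sym[OF K.ring_axioms g_iso])
    fix C assume "C \<in> carrier (T Quot M)"
    then show "?g (inv_into (carrier K) ?g C) = C"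
      using g_surj by (intro f_inv_into_f) simp
  qed
qed

text \<open>Together with \<open>exhibits_star_cover\<close>, this replaces the section by the
  elementwise condition that every element is congruent modulo the ideal to an element of the
  subfield.\<close>

lemma exhibits_starI:
  assumes "ring T" "maximalideal M T" "subfield K T"
    and cover: "\<And>x. x \<in> carrier T \<Longrightarrow> \<exists>k \<in> K. x \<ominus>\<^bsub>T\<^esub> k \<in> M"
  shows "exhibits_star T M K"
proof -
  interpret T: ring T by fact
  interpret M: maximalideal M T by fact
  have "(\<lambda>k. k) \<in> ring_hom (T\<lparr>carrier := K\<rparr>) T"
    using subfieldE(3)[OF assms(3)] by (auto simp: ring_hom_def)
  then show ?thesis
    using section_ring_iso[OF assms(1) T.subfield_iff(2)[OF assms(3)] M.is_ideal M.I_notcarr[symmetric],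
        of "\<lambda>k. k"] cover assms(2,3) unfolding exhibits_star_def by simp
qed

lemma exhibits_star_cover:
  assumes "ring R" "exhibits_star R \<mm> \<kappa>" "a \<in> carrier R"
  shows "\<exists>k \<in> \<kappa>. a \<ominus>\<^bsub>R\<^esub> k \<in> \<mm>"
proof -
  obtain j where m: "maximalideal \<mm> R" and \<kappa>: "subfield \<kappa> R"
    and j: "j \<in> ring_iso (R Quot \<mm>) (R\<lparr>carrier := \<kappa>\<rparr>)"
    and sec: "\<forall>C \<in> carrier (R Quot \<mm>). \<mm> +>\<^bsub>R\<^esub> j C = C"
    using assms(2) unfolding exhibits_star_def by blast
  interpret m: maximalideal \<mm> R by fact
  \<comment> \<open>The section value \<open>j ?C\<close> is the desired element of \<kappa>: it
    represents the same coset as \<open>a\<close>.\<close>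
  let ?C = "\<mm> +>\<^bsub>R\<^esub> a"
  have C: "?C \<in> carrier (R Quot \<mm>)"
    using ring_hom_closed[OF m.rcos_ring_hom assms(3)] .
  have k: "j ?C \<in> \<kappa>" using ring_iso_memE(1)[OF j C] by simp
  then have "j ?C \<in> carrier R" using subfieldE(3)[OF \<kappa>] by blast
  then have "a \<ominus>\<^bsub>R\<^esub> j ?C \<in> \<mm>"
    using ring.quotient_eq_iff_same_a_r_cos[OF assms(1) m.is_ideal assms(3)] sec C by auto
  then show ?thesis using k by blast
qed

text \<open>An ideal not contained in \<open>N\<close> contains a unit and is therefore the whole
  ring. So \<open>N\<close> contains every proper ideal.\<close>

lemma (in ring) maximal_ideals_if_units_outside:
  assumes "ideal N R" "N \<noteq> carrier R" and units: "carrier R - N \<subseteq> Units R"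
  shows "{I. maximalideal I R} = {N}"
proof -
  have sub: "J \<subseteq> N" if J: "ideal J R" "J \<noteq> carrier R" for J
  proof (rule ccontr)
    interpret J: ideal J R by fact
    assume "\<not> J \<subseteq> N"
    then obtain x where x: "x \<in> J" "x \<in> Units R" using units J.a_subset by blast
    then have "x \<otimes> inv x \<in> J" by (intro J.I_r_closed) auto
    then show False using x J.one_imp_carrier J(2) by simp
  qed
  have "maximalideal N R"
    using assms(1,2) sub by (intro maximalidealI) auto
  moreover have "I = N" if "maximalideal I R" for I
  proof -
    interpret I: maximalideal I R by fact
    show ?thesis
      using I.I_maximal[OF assms(1) sub[OF I.is_ideal]] I.I_notcarr assms(2)
        additive_subgroup.a_subset[OF ideal.axioms(1)[OF assms(1)]] by blast
  qed
  ultimately show ?thesis by blast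
qed

section \<open>Localization at a maximal ideal with a section\<close>

locale Ore_localization_with_section = ring R for R (structure) +
  fixes \<mm> \<kappa> :: "'a set"
  assumes star: "exhibits_star R \<mm> \<kappa>"
    and regular_outside: "s \<in> carrier R - \<mm> \<Longrightarrow> \<not> zero_divisor R s"
    and Ore_outside: "right_Ore R (carrier R - \<mm>)"
begin

section \<open>Congruences modulo \<mm>\<close>

lemma maximalideal: "maximalideal \<mm> R" and subfield: "subfield \<kappa> R"
  using star unfolding exhibits_star_def by blast+

sublocale \<mm>: maximalideal \<mm> R by (rule maximalideal)

lemma cover: "a \<in> carrier R \<Longrightarrow> \<exists>k \<in> \<kappa>. a \<ominus> k \<in> \<mm>"
  by (rule exhibits_star_cover[OF ring_axioms star])

lemma \<kappa>_carrier: "k \<in> \<kappa> \<Longrightarrow> k \<in> carrier R"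
  using subfieldE(3)[OF subfield] by blast

lemma minus_in_\<mm>: "\<lbrakk>a \<in> \<mm>; b \<in> \<mm>\<rbrakk> \<Longrightarrow> a \<ominus> b \<in> \<mm>"
  by (simp add: a_minus_def)

lemma one_notin_\<mm>: "\<one> \<notin> \<mm>"
  using \<mm>.one_imp_carrier \<mm>.I_notcarr by blast

text \<open>If \<open>b\<close> is not in \<mm>, it is congruent to a nonzero \<open>k\<close> in
  \<kappa>. Then \<open>a \<otimes> k\<close> lies in \<mm> along with \<open>a \<otimes> b\<close>,
  and multiplying by \<open>inv k\<close> on the right recovers \<open>a\<close>. Primeness for
  elements, not just for ideals, is what makes the complement of \<mm> multiplicatively
  closed.\<close>

lemma \<mm>_completely_prime:
  assumes ab: "a \<in> carrier R" "b \<in> carrier R" "a \<otimes> b \<in> \<mm>"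
  shows "a \<in> \<mm> \<or> b \<in> \<mm>"
proof (rule disjCI)
  assume "b \<notin> \<mm>"
  obtain k where k: "k \<in> \<kappa>" "b \<ominus> k \<in> \<mm>" using cover ab by blast
  have kc: "k \<in> carrier R" using k \<kappa>_carrier by blast
  have "k \<noteq> \<zero>" using \<open>b \<notin> \<mm>\<close> k ab by (auto simp: a_minus_def)
  then have inv: "inv k \<in> \<kappa>" "k \<otimes> inv k = \<one>"
    using subfield_m_inv[OF subfield, of k] k by auto
  have ic: "inv k \<in> carrier R" using inv \<kappa>_carrier by blast
  have "a \<otimes> k = a \<otimes> b \<ominus> a \<otimes> (b \<ominus> k)"
    using ab kc by (simp add: a_minus_def r_distr r_minus minus_add r_neg2)
  then have "a \<otimes> k \<in> \<mm>"
    using minus_in_\<mm> \<mm>.I_l_closed ab k by simp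
  then have "(a \<otimes> k) \<otimes> inv k \<in> \<mm>" using \<mm>.I_r_closed ic by blast
  then show "a \<in> \<mm>" using ab kc ic inv by (simp add: m_assoc)
qed

sublocale right_Ore_set R "carrier R - \<mm>"
  using one_notin_\<mm> \<mm>_completely_prime regular_outside Ore_outside
  by unfold_locales auto

sublocale Q: ring Q by (rule ring_Q)

section \<open>The ideal of fractions with numerator in \<mm>\<close>

definition N where "N = {rfrac a s | a s. a \<in> \<mm> \<and> s \<in> carrier R - \<mm>}"

text \<open>Membership does not depend on the representative: over a common value outside \<mm> the
  numerators agree, and the multiplier \<open>u\<close> is itself outside \<mm>, so complete
  primeness removes it.\<close>

lemma rfrac_in_N_iff:
  assumes "a \<in> carrier R" "s \<in> carrier R - \<mm>"
  shows "rfrac a s \<in> N \<longleftrightarrow> a \<in> \<mm>"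
proof
  assume "rfrac a s \<in> N"
  then obtain b t where b: "b \<in> \<mm>" "t \<in> carrier R - \<mm>" "rfrac a s = rfrac b t"
    unfolding N_def by blast
  obtain u v where uv: "u \<in> carrier R" "v \<in> carrier R" "s \<otimes> u = t \<otimes> v" "s \<otimes> u \<in> carrier R - \<mm>"
    using common_multiple[of s t] assms b by blast
  have "a \<otimes> u = b \<otimes> v" using frac_eqD[OF b(3)] assms b uv by simp
  then have "a \<otimes> u \<in> \<mm>" using \<mm>.I_r_closed b uv by simp
  moreover have "u \<notin> \<mm>" using \<mm>.I_l_closed uv assms by blast
  ultimately show "a \<in> \<mm>" using \<mm>_completely_prime assms uv by blast
qed (use assms in \<open>auto simp: N_def\<close>)

lemma NE:
  assumes "A \<in> N"
  obtains a s where "a \<in> \<mm>" "s \<in> carrier R - \<mm>" "A = rfrac a s"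
  using assms unfolding N_def by blast

lemma N_subset: "N \<subseteq> carrier Q"
  by (auto simp: N_def)

lemma N_l_closed:
  assumes "A \<in> N" "B \<in> carrier Q"
  shows "B \<otimes>\<^bsub>Q\<^esub> A \<in> N"
proof -
  obtain x s where x: "x \<in> carrier R" "s \<in> carrier R - \<mm>" "B = rfrac x s"
    using carrier_QE assms(2) by blast
  obtain c t where c: "c \<in> carrier R" "t \<in> carrier R - \<mm>" "A = rfrac (s \<otimes> c) t"
    using numerator_multiple[of A s] N_subset assms(1) x(2) by blast
  \<comment> \<open>Multiplication from the left needs complete primeness: the numerator of
    \<open>A\<close> was rewritten as \<open>s \<otimes> c\<close> with \<open>s\<close> outside
    \<mm>, so the membership must pass to \<open>c\<close>.\<close>
  have "s \<otimes> c \<in> \<mm>" using assms(1) c x by (simp add: rfrac_in_N_iff)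
  then have "c \<in> \<mm>" using \<mm>_completely_prime c x by blast
  then have "x \<otimes> c \<in> \<mm>" using \<mm>.I_l_closed x by blast
  then show ?thesis using x c by (simp add: frac_mult_eq rfrac_in_N_iff)
qed

lemma N_r_closed:
  assumes "A \<in> N" "B \<in> carrier Q"
  shows "A \<otimes>\<^bsub>Q\<^esub> B \<in> N"
proof -
  obtain a s where a: "a \<in> \<mm>" "s \<in> carrier R - \<mm>" "A = rfrac a s"
    using NE assms(1) by blast
  obtain c t where c: "c \<in> carrier R" "t \<in> carrier R - \<mm>" "B = rfrac (s \<otimes> c) t"
    using numerator_multiple[OF assms(2) a(2)] .
  have "a \<otimes> c \<in> \<mm>" using \<mm>.I_r_closed a c by blast
  then show ?thesis using a c by (simp add: frac_mult_eq rfrac_in_N_iff)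
qed

lemma N_ideal: "ideal N Q"
proof (rule idealI[OF ring_Q _ N_l_closed N_r_closed])
  show "subgroup N (add_monoid Q)"
  proof (rule Q.add.subgroupI)
    show "N \<noteq> {}" using \<mm>.zero_closed one_in_S unfolding N_def by blast
    fix A assume A: "A \<in> N"
    \<comment> \<open>Writing the negative as a product with minus one reduces closure under
      negation to \<open>N_l_closed\<close>.\<close>
    have "\<ominus>\<^bsub>Q\<^esub> A = (\<ominus>\<^bsub>Q\<^esub> \<one>\<^bsub>Q\<^esub>) \<otimes>\<^bsub>Q\<^esub> A"
      using A N_subset by (simp add: Q.l_minus subset_iff)
    then show "\<ominus>\<^bsub>Q\<^esub> A \<in> N" using N_l_closed[OF A] by simp
    fix B assume B: "B \<in> N"
    obtain a b s where "a \<in> carrier R" "b \<in> carrier R" "s \<in> carrier R - \<mm>"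
      "A = rfrac a s" "B = rfrac b s"
      using common_denominator_2[of A B] A B N_subset by blast
    then show "A \<oplus>\<^bsub>Q\<^esub> B \<in> N"
      using A B by (simp add: frac_add_eq rfrac_in_N_iff)
  qed (rule N_subset)
qed

lemma one_notin_N: "\<one>\<^bsub>Q\<^esub> \<notin> N"
  using one_notin_\<mm> by (simp add: one_Q rfrac_in_N_iff)

text \<open>A fraction outside \<open>N\<close> has its numerator outside \<mm>, so exchanging
  numerator and denominator gives its inverse.\<close>

lemma maximal_ideals_Q: "{I. maximalideal I Q} = {N}"
proof (rule Q.maximal_ideals_if_units_outside[OF N_ideal])
  show "N \<noteq> carrier Q" using one_notin_N Q.one_closed by blast
  show "carrier Q - N \<subseteq> Units Q"
  proof
    fix A assume A: "A \<in> carrier Q - N"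
    then obtain a s where a: "a \<in> carrier R" "s \<in> carrier R - \<mm>" "A = rfrac a s"
      using carrier_QE by blast
    then show "A \<in> Units Q" using A by (simp add: rfrac_in_N_iff frac_Units)
  qed
qed

text \<open>The factorization of \<open>a/s\<close> as \<open>a/1\<close> times \<open>1/s\<close>
  shows that right multiples of the generators already exhaust \<open>N\<close>.\<close>

lemma extended_ideal_eq: "extended_ideal R \<mm> = N"
proof -
  let ?E = "(\<lambda>a. rfrac a \<one>) ` \<mm>"
  have E_carrier: "?E \<subseteq> carrier Q" using one_in_S by auto
  interpret I: ideal "Idl\<^bsub>Q\<^esub> ?E" Q by (rule Q.genideal_ideal[OF E_carrier])
  have "Idl\<^bsub>Q\<^esub> ?E \<subseteq> N"
    using one_in_S by (intro Q.genideal_minimal[OF N_ideal]) (auto simp: rfrac_in_N_iff)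
  moreover have "N \<subseteq> Idl\<^bsub>Q\<^esub> ?E"
  proof
    fix A assume "A \<in> N"
    then obtain a s where a: "a \<in> \<mm>" "s \<in> carrier R - \<mm>" "A = rfrac a s" by (rule NE)
    have "rfrac a \<one> \<in> Idl\<^bsub>Q\<^esub> ?E" using Q.genideal_self[OF E_carrier] a by blast
    then have "rfrac a \<one> \<otimes>\<^bsub>Q\<^esub> rfrac \<one> s \<in> Idl\<^bsub>Q\<^esub> ?E"
      using a by (intro I.I_r_closed) auto
    then show "A \<in> Idl\<^bsub>Q\<^esub> ?E" using a frac_decompose[of a s] by simp
  qed
  ultimately show ?thesis
    unfolding extended_ideal_def localization_at_def loc_embed_def by blast
qed

section \<open>The residue field of the localization\<close>

lemma cover_Q:
  assumes "A \<in> carrier Q"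
  shows "\<exists>k \<in> \<kappa>. A \<ominus>\<^bsub>Q\<^esub> rfrac k \<one> \<in> N"
proof -
  obtain a s where a: "a \<in> carrier R" "s \<in> carrier R - \<mm>" "A = rfrac a s"
    using assms carrier_QE by blast
  obtain k where k: "k \<in> \<kappa>" "a \<ominus> k \<in> \<mm>" using cover a by blast
  obtain l where l: "l \<in> \<kappa>" "s \<ominus> l \<in> \<mm>" using cover a by blast
  \<comment> \<open>If \<open>l\<close> were zero, the congruence would put the denominator
    \<open>s\<close> into \<mm>.\<close>
  have "l \<noteq> \<zero>" using a l by (auto simp: a_minus_def)
  then have inv: "inv l \<in> \<kappa>" "inv l \<otimes> l = \<one>"
    using subfield_m_inv[OF subfield, of l] l by auto
  let ?q = "k \<otimes> inv l"
  have q: "?q \<in> \<kappa>" using subringE(6)[OF subfieldE(1)[OF subfield]] k inv by blast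
  have car: "k \<in> carrier R" "l \<in> carrier R" "inv l \<in> carrier R" "s \<in> carrier R" "?q \<in> carrier R"
    using k l inv q a \<kappa>_carrier by auto
  have ql: "?q \<otimes> l = k" using car inv by (simp add: m_assoc)
  define z where "z = ?q \<otimes> s"
  have z: "z \<in> carrier R" using car unfolding z_def by blast
  \<comment> \<open>Since \<open>?q \<otimes> l = k\<close>, replacing \<open>l\<close> by the
    congruent \<open>s\<close> shows that \<open>z = ?q \<otimes> s\<close> is congruent to
    \<open>k\<close>, hence to \<open>a\<close>. This is the numerator congruence needed once
    \<open>?q\<close> is written over the denominator \<open>s\<close>.\<close>
  have "?q \<otimes> (s \<ominus> l) = z \<ominus> k"
    using car(2,4,5) ql unfolding z_def by (simp add: a_minus_def r_distr r_minus del: m_closed)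
  then have "z \<ominus> k \<in> \<mm>" using \<mm>.I_l_closed[OF l(2) car(5)] by simp
  then have "(a \<ominus> k) \<ominus> (z \<ominus> k) \<in> \<mm>" using minus_in_\<mm> k by blast
  moreover have "(a \<ominus> k) \<ominus> (z \<ominus> k) = a \<ominus> z"
    using a(1) car(1) z by (simp add: a_minus_def minus_add a_ac r_neg2 r_neg1)
  ultimately have num: "a \<ominus> z \<in> \<mm>" by simp
  let ?F = "rfrac (a \<ominus> z) s" and ?G = "rfrac ?q \<one>"
  have G: "?G = rfrac z s"
    using frac_expand[of ?q \<one> s] a(2) car(4,5) one_in_S unfolding z_def by simp
  \<comment> \<open>The difference of fractions is obtained by solving a sum over the common
    denominator \<open>s\<close>.\<close>
  have "(a \<ominus> z) \<oplus> z = a"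
    using a(1) z by (simp add: a_minus_def a_assoc l_neg)
  then have "A = ?F \<oplus>\<^bsub>Q\<^esub> ?G"
    using frac_add_eq[of "a \<ominus> z" z s] a z unfolding G by simp
  moreover have "?F \<in> carrier Q" "?G \<in> carrier Q"
    using a z unfolding G by simp_all
  ultimately have "A \<ominus>\<^bsub>Q\<^esub> ?G = ?F"
    by (simp add: a_minus_def Q.a_assoc Q.r_neg)
  moreover have "?F \<in> N" using num a unfolding N_def by blast
  ultimately have "A \<ominus>\<^bsub>Q\<^esub> ?G \<in> N" by simp
  then show ?thesis using q by blast
qed

sublocale \<iota>: ring_hom_ring R Q "\<lambda>a. rfrac a \<one>"
  by (rule ring_hom_ringI2[OF ring_axioms ring_Q frac_one_ring_hom])

lemma \<kappa>_image_subfield: "subfield ((\<lambda>a. rfrac a \<one>) ` \<kappa>) Q"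
proof -
  have "\<one>\<^bsub>Q\<^esub> \<noteq> \<zero>\<^bsub>Q\<^esub>"
    using one_notin_N additive_subgroup.zero_closed[OF ideal.axioms(1)[OF N_ideal]] by auto
  then show ?thesis by (rule \<iota>.img_is_subfield(2)[OF subfield])
qed

lemma exhibits_star_Q: "exhibits_star Q N ((\<lambda>a. rfrac a \<one>) ` \<kappa>)"
  using maximal_ideals_Q cover_Q by (intro exhibits_starI ring_Q \<kappa>_image_subfield) auto

text \<open>Here \<open>section_ring_iso\<close> is used with the embedding as \<open>h\<close>, so
  the isomorphism lands in \<kappa> inside the original ring, whereas \<open>exhibits_star_Q\<close>
  uses the image of \<kappa> among the fractions.\<close>

lemma residue_ring_iso:
  "\<exists>j \<in> ring_iso (Q Quot N) (R\<lparr>carrier := \<kappa>\<rparr>).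
     \<forall>C \<in> carrier (Q Quot N). N +>\<^bsub>Q\<^esub> rfrac (j C) \<one> = C"
proof (rule section_ring_iso[OF ring_Q subfield_iff(2)[OF subfield] N_ideal])
  show "N \<noteq> carrier Q" using one_notin_N Q.one_closed by blast
  show "(\<lambda>a. rfrac a \<one>) \<in> ring_hom (R\<lparr>carrier := \<kappa>\<rparr>) Q"
    by (rule ring_hom_ring.homh[OF \<iota>.induced_ring_hom[OF subfieldE(1)[OF subfield]]])
  show "\<exists>k \<in> carrier (R\<lparr>carrier := \<kappa>\<rparr>). A \<ominus>\<^bsub>Q\<^esub> rfrac k \<one> \<in> N" if "A \<in> carrier Q" for A
    using cover_Q[OF that] by simp
qed

end

theorem proposition4p9:
  fixes R :: "('a, 'm) ring_scheme" and \<mm> \<kappa> :: "'a set"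
  assumes "ring R"
    and "exhibits_star R \<mm> \<kappa>"
    and "\<forall>s \<in> carrier R - \<mm>. \<not> zero_divisor R s"
    and "right_Ore R (carrier R - \<mm>)"
  shows "ring (localization_at R \<mm>)
    \<and> loc_embed R \<mm> \<in> ring_hom R (localization_at R \<mm>)
    \<and> inj_on (loc_embed R \<mm>) (carrier R)
    \<and> property_star (localization_at R \<mm>)
    \<and> {I. maximalideal I (localization_at R \<mm>)} = {extended_ideal R \<mm>}
    \<and> exhibits_star (localization_at R \<mm>) (extended_ideal R \<mm>) (loc_embed R \<mm> ` \<kappa>)
    \<and> (\<exists>j \<in> ring_iso (localization_at R \<mm> Quot extended_ideal R \<mm>) (R\<lparr>carrier := \<kappa>\<rparr>).
         \<forall>C \<in> carrier (localization_at R \<mm> Quot extended_ideal R \<mm>).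
           extended_ideal R \<mm> +>\<^bsub>localization_at R \<mm>\<^esub> loc_embed R \<mm> (j C) = C)"
proof -
  interpret ring R by fact
  interpret Ore_localization_with_section R \<mm> \<kappa>
    using assms(2-4) by unfold_locales auto
  have embed: "loc_embed R \<mm> = (\<lambda>a. rfrac a \<one>\<^bsub>R\<^esub>)"
    by (simp add: loc_embed_def fun_eq_iff)
  show ?thesis
    unfolding localization_at_def extended_ideal_eq embed property_star_def
    using ring_Q frac_one_ring_hom frac_one_inj maximal_ideals_Q exhibits_star_Q residue_ring_iso
    by blast
qed

end
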